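(* Let $\mathcal{G}=(\mathcal{V},\mathcal{E})$, $\mathcal{V}=\{1,\dots,N\}$, be an undirected graph. For each $i\in\mathcal{V}$ let $f_i:\mathbb{R}^n\to\mathbb{R}$ be $\mu$-strongly convex and $L$-smooth, with $\mu,L>0$ independent of $i$. Let $W\in\mathbb{R}^{N\times N}$ be a doubly stochastic matrix of communication weights on $\mathcal{G}$, let $\lambda_{\min}(W)$ be the smallest eigenvalue of $W$, let $\alpha>0$ be a step size, and let $\Lambda=\operatorname{diag}(\lambda_1,\dots,\lambda_N)$ with $\lambda_i\in[0,1]$. Let $\boldsymbol{x}^*=[(x_1^* )^\top,\dots,(x_N^* )^\top]^\top$ with $x_i^*=\arg\min_{x\in\mathbb{R}^n} f_i(x)$, and let $\bar{\boldsymbol{x}}$ be the fixed point of the distributed gradient descent iteration $\boldsymbol{x}_{k+1}=W\boldsymbol{x}_k-\alpha\nabla f(\boldsymbol{x}_k)$. Then the algorithm $$ \begin{aligned} \boldsymbol{y}_{k+1}&=\boldsymbol{y}_k-\alpha\nabla f(\boldsymbol{y}_k),\qquad \boldsymbol{y}_0=\boldsymbol{x}_0,\\ \boldsymbol{z}_{k+1}&=W\boldsymbol{z}_k-\alpha\nabla f(\boldsymbol{z}_k),\qquad \boldsymbol{z}_0=\boldsymbol{x}_0,\\ \boldsymbol{x}_{k+1}&=\Lambda\boldsymbol{y}_{k+1}+(I-\Lambda)\boldsymbol{z}_{k+1} \end{aligned} $$ converges linearly (i.e. $\boldsymbol{x}_k$ converges linearly) to $\Lambda\boldsymbol{x}^*+(I-\Lambda)\bar{\boldsymbol{x}}$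 at a rate of $$ \zeta=\max\left\{|1-\alpha\mu|,\ |1-\alpha L|,\ |\lambda_{\min}(W)-\alpha L|\right\}. $$
   Context: Vectors in $\mathbb{R}^{Nn}$ are stacks $\boldsymbol{x}=[x_1^\top,\dots,x_N^\top]^\top$ with $x_i\in\mathbb{R}^n$ the variable of agent $i$; $\nabla f(\boldsymbol{x})=[\nabla f_1(x_1)^\top,\dots,\nabla f_N(x_N)^\top]^\top$ is the stack of local gradients, and $f_i$ is the local loss of agent $i$. The $N\times N$ matrices $W$ and $\Lambda$ act blockwise on $\mathbb{R}^{Nn}$, i.e. $W\boldsymbol{x}$ means $(W\otimes I_n)\boldsymbol{x}$ and $\Lambda\boldsymbol{x}$ means $(\Lambda\otimes I_n)\boldsymbol{x}$. Agents exchange information only with their neighbors in $\mathcal{G}$, so the off-diagonal entry $w_{ij}$ of $W$ is zero when $(i,j)\notin\mathcal{E}$. $\|\cdot\|$ is the Euclidean norm. "Linear convergence" means geometric convergence. A function $g$ is $\mu$-strongly convex ($\mu>0$) if $g(y)\ge g(x)+\nabla g(x)^\top(y-x)+\frac{\mu}{2}\|y-x\|^2$ for all $x,y$, and $L$-smooth if $\nabla g$ is globally Lipschitz with constant $L>0$.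
   Formalization: W is assumed symmetric (for non-symmetric W the rate can fail), and convergence is claimed only when ζ<1 (for large α the iterates can diverge); the bound ‖x_k − limit‖ ≤ Cζ^k is proved for every α>0. *)

theory Defs
  imports "HOL-Analysis.Analysis"
begin

definition grad :: "('a::real_inner \<Rightarrow> real) \<Rightarrow> 'a \<Rightarrow> 'a" where
  "grad g x = (THE D. GDERIV g x :> D)"

definition strongly_convex :: "real \<Rightarrow> ('a::real_inner \<Rightarrow> real) \<Rightarrow> bool" where
  "strongly_convex \<mu> g \<longleftrightarrow> 0 < \<mu> \<and> (\<forall>x. g differentiable (at x)) \<and>
     (\<forall>x y. g y \<ge> g x + grad g x \<bullet> (y - x) + \<mu> / 2 * (norm (y - x))\<^sup>2)"

definition smooth_fun :: "real \<Rightarrow> ('a::real_inner \<Rightarrow> real) \<Rightarrow> bool" where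
  "smooth_fun L g \<longleftrightarrow> 0 < L \<and> (\<forall>x. g differentiable (at x)) \<and> L-lipschitz_on UNIV (grad g)"

text \<open>A stacked vector of agent variables has type \<open>real^'n^'v\<close>: component \<open>x $ i\<close> is the
  variable of agent \<open>i\<close>, and the library norm on this type is the Euclidean norm of the stack.\<close>

definition stack_grad :: "('v \<Rightarrow> real^'n \<Rightarrow> real) \<Rightarrow> real^'n^'v \<Rightarrow> real^'n^'v" where
  "stack_grad f x = (\<chi> i. grad (f i) (x $ i))"

text \<open>The action of the Kronecker product of \<open>A\<close> with the identity on stacked vectors.\<close>

definition block_mult :: "real^'v^'v \<Rightarrow> real^'n^'v \<Rightarrow> real^'n^'v"  (infixr "*b" 75) where
  "A *b x = (\<chi> i. \<Sum>j\<in>UNIV. A $ i $ j *\<^sub>R x $ j)"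

definition diag_matrix :: "('v \<Rightarrow> real) \<Rightarrow> real^'v^'v" where
  "diag_matrix d = (\<chi> i j. if i = j then d i else 0)"

definition doubly_stochastic :: "real^'v^'v \<Rightarrow> bool" where
  "doubly_stochastic A \<longleftrightarrow> (\<forall>i j. 0 \<le> A $ i $ j) \<and>
     (\<forall>i. (\<Sum>j\<in>UNIV. A $ i $ j) = 1) \<and> (\<forall>j. (\<Sum>i\<in>UNIV. A $ i $ j) = 1)"

definition communication_weights :: "('v \<times> 'v) set \<Rightarrow> real^'v^'v \<Rightarrow> bool" where
  "communication_weights E A \<longleftrightarrow> (\<forall>i j. i \<noteq> j \<longrightarrow> (i, j) \<notin> E \<longrightarrow> A $ i $ j = 0)"

definition is_eigenvalue :: "real^'v^'v \<Rightarrow> real \<Rightarrow> bool" where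
  "is_eigenvalue A l \<longleftrightarrow> (\<exists>v. v \<noteq> 0 \<and> A *v v = l *\<^sub>R v)"

text \<open>Only meaningful when the spectrum of \<open>A\<close> is real, in particular for symmetric \<open>A\<close>.\<close>

definition lambda_min :: "real^'v^'v \<Rightarrow> real" where
  "lambda_min A = (LEAST l. is_eigenvalue A l)"

text \<open>Geometric convergence with rate \<open>r\<close> is the bound below together with \<open>r < 1\<close>; for
  \<open>r \<ge> 1\<close> the bound alone still limits the growth of the error.\<close>

definition geometric_bound :: "(nat \<Rightarrow> 'a::real_normed_vector) \<Rightarrow> 'a \<Rightarrow> real \<Rightarrow> bool" where
  "geometric_bound X l r \<longleftrightarrow> (\<exists>C\<ge>0. \<forall>k. norm (X k - l) \<le> C * r ^ k)"

definition converges_linearly :: "(nat \<Rightarrow> 'a::real_normed_vector) \<Rightarrow> 'a \<Rightarrow> real \<Rightarrow> bool" where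
  "converges_linearly X l r \<longleftrightarrow> 0 \<le> r \<and> r < 1 \<and> X \<longlonglongrightarrow> l \<and> geometric_bound X l r"

end

theory Submission
  imports Defs
begin

text \<open>
  Each local gradient differs from multiplication by \<open>(\<mu> + L) / 2\<close> by a map with Lipschitz
  constant \<open>(L - \<mu>) / 2\<close> (this is co-coercivity), and the symmetric operator \<open>W\<close>, whose
  quadratic form lies between \<open>\<lambda> = lambda_min W\<close> and \<open>1\<close>, differs from multiplication by
  \<open>(1 + \<lambda>) / 2\<close> by an operator of norm at most \<open>(1 - \<lambda>) / 2\<close>. By the triangle inequality
  \<open>W x - \<alpha> \<nabla>f x\<close> is Lipschitz with constant
  \<open>\<bar>(1 + \<lambda>) / 2 - \<alpha> (\<mu> + L) / 2\<bar> + (1 - \<lambda>) / 2 + \<alpha> (L - \<mu>) / 2 = max \<bar>1 - \<alpha> \<mu>\<bar> \<bar>\<lambda> - \<alpha> L\<bar>\<close>,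
  and the same argument with the identity in place of \<open>W\<close> handles the plain gradient iteration.
\<close>

subsection \<open>Gradients of strongly convex smooth functions\<close>

text \<open>Riesz representation: the values of the derivative on \<open>Basis\<close> are the
  coordinates of a gradient vector, and uniqueness of the derivative makes the description in
  \<open>grad\<close> select that vector.\<close>

lemma GDERIV_grad:
  fixes g :: "'a::euclidean_space \<Rightarrow> real"
  assumes "g differentiable (at x)"
  shows "GDERIV g x :> grad g x"
proof -
  obtain g' where g': "(g has_derivative g') (at x)"
    using assms unfolding differentiable_def by blast
  have lin: "linear g'" using g' by (rule has_derivative_linear)
  define D where "D = (\<Sum>b\<in>Basis. g' b *\<^sub>R b)"
  have "g' h = h \<bullet> D" for h
  proof -
    have "g' h = g' (\<Sum>b\<in>Basis. (h \<bullet> b) *\<^sub>R b)" by (simp add: euclidean_representation)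
    also have "\<dots> = (\<Sum>b\<in>Basis. (h \<bullet> b) * g' b)"
      using lin by (simp add: linear_sum linear_cmul)
    also have "\<dots> = h \<bullet> D"
      unfolding D_def by (simp add: inner_sum_right mult.commute)
    finally show ?thesis .
  qed
  then have "g' = (\<lambda>h. h \<bullet> D)" by (rule ext)
  then have D: "GDERIV g x :> D" using g' unfolding gderiv_def by simp
  show ?thesis unfolding grad_def
  proof (rule theI)
    show "GDERIV g x :> D" by (rule D)
    show "E = D" if "GDERIV g x :> E" for E
    proof -
      have "(\<lambda>h. h \<bullet> E) = (\<lambda>h. h \<bullet> D)"
        using that D unfolding gderiv_def by (rule has_derivative_unique)
      then show ?thesis by (metis vector_eq_ldot)
    qed
  qed
qed

lemma grad_eq_0_if_is_arg_min:
  fixes g :: "'a::euclidean_space \<Rightarrow> real"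
  assumes "g differentiable (at x)" and "is_arg_min g (\<lambda>_. True) x"
  shows "grad g x = 0"
proof -
  have "(g has_derivative (\<lambda>h. h \<bullet> grad g x)) (at x)"
    using GDERIV_grad[OF assms(1)] unfolding gderiv_def .
  moreover have "eventually (\<lambda>w. g x \<le> g w) (at x)"
    using assms(2) by (auto simp: is_arg_min_linorder)
  ultimately have "(\<lambda>h. h \<bullet> grad g x) = (\<lambda>h. 0)"
    by (rule has_derivative_local_min)
  then show ?thesis by (metis inner_eq_zero_iff)
qed

text \<open>Descent lemma: along the segment from \<open>x\<close> to \<open>y\<close> the slope
  grows at most linearly, by the Lipschitz bound on the gradient and Cauchy-Schwarz.\<close>

lemma smooth_fun_upper_bound:
  fixes g :: "'a::euclidean_space \<Rightarrow> real"
  assumes "smooth_fun L g"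
  shows "g y \<le> g x + grad g x \<bullet> (y - x) + L / 2 * (norm (y - x))\<^sup>2"
proof -
  define d where "d = y - x"
  \<comment> \<open>\<open>\<phi>\<close> is \<open>g\<close> on the segment minus its claimed
    quadratic bound, up to the constant \<open>g x\<close>; the claim is then
    \<open>\<phi> 1 \<le> \<phi> 0\<close>.\<close>
  define \<phi> where "\<phi> t = g (x + t *\<^sub>R d) - t * (grad g x \<bullet> d) - L / 2 * t\<^sup>2 * (norm d)\<^sup>2" for t
  have diff: "g differentiable (at u)" for u
    using assms unfolding smooth_fun_def by blast
  have lip: "norm (grad g u - grad g v) \<le> L * norm (u - v)" for u v
    using assms unfolding smooth_fun_def by (metis dist_norm lipschitz_onD UNIV_I)
  have der: "(\<phi> has_real_derivative (d \<bullet> grad g (x + t *\<^sub>R d) - grad g x \<bullet> d - L * t * (norm d)\<^sup>2)) (at t)"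
    for t
  proof -
    have "(g has_derivative (\<lambda>h. h \<bullet> grad g (x + t *\<^sub>R d))) (at (x + t *\<^sub>R d))"
      using GDERIV_grad[OF diff] unfolding gderiv_def .
    moreover have "((\<lambda>t. x + t *\<^sub>R d) has_derivative (\<lambda>s. s *\<^sub>R d)) (at t)"
      by (auto intro!: derivative_eq_intros)
    ultimately have "((\<lambda>t. g (x + t *\<^sub>R d)) has_derivative (\<lambda>s. (s *\<^sub>R d) \<bullet> grad g (x + t *\<^sub>R d))) (at t)"
      by (rule has_derivative_compose[rotated])
    then have "((\<lambda>t. g (x + t *\<^sub>R d)) has_real_derivative (d \<bullet> grad g (x + t *\<^sub>R d))) (at t)"
      unfolding has_field_derivative_def by (simp add: mult_commute_abs)
    then show ?thesis unfolding \<phi>_def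
      by (auto intro!: derivative_eq_intros)
  qed
  have "\<phi> 1 \<le> \<phi> 0"
  proof (rule DERIV_nonpos_imp_nonincreasing[of 0 1 \<phi>])
    fix t :: real assume t: "0 \<le> t" "t \<le> 1"
    have "d \<bullet> grad g (x + t *\<^sub>R d) - grad g x \<bullet> d = d \<bullet> (grad g (x + t *\<^sub>R d) - grad g x)"
      by (simp add: inner_diff_right inner_commute)
    also have "\<dots> \<le> norm d * norm (grad g (x + t *\<^sub>R d) - grad g x)"
      by (rule norm_cauchy_schwarz)
    also have "\<dots> \<le> norm d * (L * norm (x + t *\<^sub>R d - x))"
      by (intro mult_left_mono lip) simp
    also have "\<dots> = L * t * (norm d)\<^sup>2"
      using t by (simp add: power2_eq_square)
    finally show "\<exists>D. DERIV \<phi> t :> D \<and> D \<le> 0"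
      using der[of t] by fastforce
  qed simp_all
  then show ?thesis unfolding \<phi>_def d_def by simp
qed

text \<open>\<open>M = 0\<close> must be allowed: it is the case \<open>\<mu> = L\<close> in \<open>grad_near_scaling\<close>.\<close>

lemma cocoercive:
  fixes h :: "'a::real_inner \<Rightarrow> real"
  assumes lower: "\<And>x y. h x + p x \<bullet> (y - x) \<le> h y"
    and upper: "\<And>x y. h y \<le> h x + p x \<bullet> (y - x) + M / 2 * (norm (y - x))\<^sup>2"
    and "0 \<le> M"
  shows "(norm (p x - p y))\<^sup>2 \<le> M * ((p x - p y) \<bullet> (x - y))"
proof -
  define q where "q = (norm (p x - p y))\<^sup>2"
  define s where "s = (p x - p y) \<bullet> (x - y)"
  \<comment> \<open>Both bounds are evaluated at the point \<open>w\<close>, reached from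
    \<open>v\<close> by a step \<open>t\<close> along the gradient difference. The step stays free
    because the cases below choose it differently.\<close>
  have one: "h u - h v + p u \<bullet> (v - u) \<le> (M / 2 * t\<^sup>2 - t) * (norm (p u - p v))\<^sup>2" for u v t
  proof -
    define w where "w = v + t *\<^sub>R (p u - p v)"
    have "h u + p u \<bullet> (w - u) \<le> h v + p v \<bullet> (w - v) + M / 2 * (norm (w - v))\<^sup>2"
      using lower[of u w] upper[of w v] by linarith
    moreover have "p u \<bullet> (w - u) - p v \<bullet> (w - v) = p u \<bullet> (v - u) + t * (norm (p u - p v))\<^sup>2"
      unfolding w_def power2_norm_eq_inner by (simp add: algebra_simps inner_commute)
    moreover have "(norm (w - v))\<^sup>2 = t\<^sup>2 * (norm (p u - p v))\<^sup>2"
      unfolding w_def by (simp add: power_mult_distrib)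
    ultimately show ?thesis by (simp add: algebra_simps)
  qed
  \<comment> \<open>Adding both orientations of the pair cancels the values of
    \<open>h\<close>.\<close>
  have two: "(2 * t - M * t\<^sup>2) * q \<le> s" for t
    using one[of x y t] one[of y x t] unfolding q_def s_def
    by (simp add: norm_minus_commute algebra_simps)
  have "0 \<le> q" unfolding q_def by simp
  have "q \<le> M * s"
  proof (cases "M = 0")
    case True
    \<comment> \<open>For \<open>M = 0\<close> the bound is linear in \<open>t\<close>; this
      \<open>t\<close> turns it into \<open>s + 1 \<le> s\<close>.\<close>
    have "q = 0"
    proof (rule ccontr)
      assume "q \<noteq> 0"
      then show False using two[of "(s + 1) / (2 * q)"] True by simp
    qed
    then show ?thesis using True by simp
  next
    case False
    then have "0 < M" using \<open>0 \<le> M\<close> by simp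
    \<comment> \<open>\<open>t = 1 / M\<close> maximises
      \<open>2 * t - M * t\<^sup>2\<close>.\<close>
    then have "q / M \<le> s" using two[of "1 / M"] by (simp add: power2_eq_square)
    then show ?thesis using \<open>0 < M\<close> by (simp add: field_simps)
  qed
  then show ?thesis unfolding q_def s_def .
qed

lemma strongly_convex_le_smooth:
  fixes g :: "'a::euclidean_space \<Rightarrow> real"
  assumes "strongly_convex \<mu> g" and "smooth_fun L g"
  shows "\<mu> \<le> L"
proof -
  obtain b :: 'a where b: "norm b = 1" using norm_Basis nonempty_Basis by blast
  have "g b \<ge> g 0 + grad g 0 \<bullet> (b - 0) + \<mu> / 2 * (norm (b - 0))\<^sup>2"
    using assms(1) unfolding strongly_convex_def by blast
  with smooth_fun_upper_bound[OF assms(2), of b 0] b show ?thesis by simp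
qed

text \<open>Removing the quadratic \<open>\<mu> / 2 * (norm u)\<^sup>2\<close> from \<open>g\<close>
  leaves a convex \<open>h\<close> with gradient \<open>p\<close>, to which co-coercivity applies
  with \<open>M = L - \<mu>\<close>. Completing the square, that inequality says exactly that
  \<open>q\<close> lies in the ball with centre \<open>((L - \<mu>) / 2) *\<^sub>R d\<close> and
  radius \<open>(L - \<mu>) / 2 * norm d\<close>.\<close>

lemma grad_near_scaling:
  fixes g :: "'a::euclidean_space \<Rightarrow> real"
  assumes sc: "strongly_convex \<mu> g" and sm: "smooth_fun L g"
  shows "norm (grad g x - grad g y - ((\<mu> + L) / 2) *\<^sub>R (x - y)) \<le> (L - \<mu>) / 2 * norm (x - y)"
proof -
  define h where "h u = g u - \<mu> / 2 * (norm u)\<^sup>2" for u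
  define p where "p u = grad g u - \<mu> *\<^sub>R u" for u
  have shift: "h v - h u - p u \<bullet> (v - u) =
      g v - g u - grad g u \<bullet> (v - u) - \<mu> / 2 * (norm (v - u))\<^sup>2" for u v
    unfolding h_def p_def power2_norm_eq_inner
    by (simp add: algebra_simps inner_commute)
  have lower: "h u + p u \<bullet> (v - u) \<le> h v" for u v
  proof -
    have "g v \<ge> g u + grad g u \<bullet> (v - u) + \<mu> / 2 * (norm (v - u))\<^sup>2"
      using sc unfolding strongly_convex_def by blast
    then show ?thesis using shift[of v u] by linarith
  qed
  have upper: "h v \<le> h u + p u \<bullet> (v - u) + (L - \<mu>) / 2 * (norm (v - u))\<^sup>2" for u v
    using smooth_fun_upper_bound[OF sm, of v u] shift[of v u]
    by (simp add: diff_divide_distrib left_diff_distrib)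
  have \<mu>L: "0 \<le> L - \<mu>" using strongly_convex_le_smooth[OF sc sm] by simp
  define d where "d = x - y"
  define q where "q = p x - p y"
  have c: "q \<bullet> q \<le> (L - \<mu>) * (q \<bullet> d)"
    using cocoercive[of h p "L - \<mu>" x y, OF lower upper \<mu>L] unfolding q_def d_def power2_norm_eq_inner .
  have eq: "grad g x - grad g y - ((\<mu> + L) / 2) *\<^sub>R (x - y) = q - ((L - \<mu>) / 2) *\<^sub>R d"
  proof -
    have "((\<mu> + L) / 2) *\<^sub>R d = \<mu> *\<^sub>R d + ((L - \<mu>) / 2) *\<^sub>R d"
      by (simp add: scaleR_add_left[symmetric] field_simps)
    then show ?thesis unfolding q_def p_def d_def by (simp add: algebra_simps)
  qed
  have "(norm (q - ((L - \<mu>) / 2) *\<^sub>R d))\<^sup>2 =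
      q \<bullet> q - (L - \<mu>) * (q \<bullet> d) + ((L - \<mu>) / 2)\<^sup>2 * (d \<bullet> d)"
    unfolding power2_norm_eq_inner
    by (simp add: inner_diff_left inner_diff_right inner_commute power2_eq_square)
  also have "\<dots> \<le> ((L - \<mu>) / 2)\<^sup>2 * (d \<bullet> d)" using c by simp
  also have "\<dots> = ((L - \<mu>) / 2 * norm d)\<^sup>2" by (simp only: power_mult_distrib power2_norm_eq_inner)
  finally have "norm (q - ((L - \<mu>) / 2) *\<^sub>R d) \<le> (L - \<mu>) / 2 * norm d"
    by (rule power2_le_imp_le) (use \<mu>L in simp)
  then show ?thesis unfolding eq d_def .
qed

text \<open>Serves twice: with \<open>r = (L - \<mu>) / 2\<close> for the stacked gradients and with
  \<open>r = 1\<close> for diagonal weights.\<close>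

lemma norm_stack_le:
  fixes u v :: "real^'n^'v::finite"
  assumes "\<And>i. norm (u $ i) \<le> r * norm (v $ i)" and "0 \<le> r"
  shows "norm u \<le> r * norm v"
proof -
  have "norm u \<le> norm (r *\<^sub>R v)"
    by (rule norm_le_componentwise_cart) (use assms in simp)
  then show ?thesis using assms(2) by simp
qed

lemma stack_grad_near_scaling:
  fixes f :: "'v::finite \<Rightarrow> real^'n \<Rightarrow> real"
  assumes "\<And>i. strongly_convex \<mu> (f i)" and "\<And>i. smooth_fun L (f i)"
  shows "norm (stack_grad f x - stack_grad f y - ((\<mu> + L) / 2) *\<^sub>R (x - y))
    \<le> (L - \<mu>) / 2 * norm (x - y)"
proof (rule norm_stack_le)
  show "norm ((stack_grad f x - stack_grad f y - ((\<mu> + L) / 2) *\<^sub>R (x - y)) $ i)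
      \<le> (L - \<mu>) / 2 * norm ((x - y) $ i)" for i
    using grad_near_scaling[OF assms(1)[of i] assms(2)[of i], of "x $ i" "y $ i"] by (simp add: stack_grad_def)
  show "0 \<le> (L - \<mu>) / 2" using strongly_convex_le_smooth[OF assms(1) assms(2)] by simp
qed

subsection \<open>Symmetric operators and the smallest eigenvalue\<close>

text \<open>Polarisation turns a bound on the quadratic form into a bound on the operator norm,
  without diagonalising \<open>A\<close>.\<close>

lemma selfadjoint_norm_le:
  fixes A :: "'a::real_inner \<Rightarrow> 'a"
  assumes lin: "linear A"
    and sym: "\<And>u v. A u \<bullet> v = u \<bullet> A v"
    and bound: "\<And>u. \<bar>A u \<bullet> u\<bar> \<le> r * (u \<bullet> u)"
  shows "norm (A u) \<le> r * norm u"
proof (cases "A u = 0 \<or> u = 0")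
  case True
  have "0 \<le> r * norm u"
  proof (cases "u = 0")
    case False
    have "0 \<le> r * (u \<bullet> u)" using bound[of u] by linarith
    then have "0 \<le> r" using False by (metis inner_gt_zero_iff mult.commute mult_neg_pos not_less)
    then show ?thesis by simp
  qed simp
  then show ?thesis using True linear_0[OF lin] by auto
next
  case False
  then have pos: "0 < norm (A u)" "0 < norm u" by auto
  \<comment> \<open>The vector along \<open>A u\<close> with the length of \<open>u\<close>: it
    makes \<open>A u \<bullet> v\<close> equal to \<open>norm u * norm (A u)\<close>, and equal
    lengths make the polarised bound tight.\<close>
  define v where "v = (norm u / norm (A u)) *\<^sub>R A u"
  have nv: "v \<bullet> v = u \<bullet> u"
    using pos unfolding v_def by (simp add: dot_square_norm power2_eq_square)
  have "4 * (A u \<bullet> v) = A (u + v) \<bullet> (u + v) - A (u - v) \<bullet> (u - v)"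
    using sym[of v u] by (simp add: linear_add[OF lin] linear_diff[OF lin] algebra_simps inner_commute)
  also have "\<dots> \<le> r * ((u + v) \<bullet> (u + v)) + r * ((u - v) \<bullet> (u - v))"
    using bound[of "u + v"] bound[of "u - v"] by linarith
  also have "\<dots> = 2 * r * (u \<bullet> u) + 2 * r * (v \<bullet> v)"
    by (simp add: algebra_simps inner_commute)
  finally have "A u \<bullet> v \<le> r * (norm u)\<^sup>2" using nv by (simp add: dot_square_norm)
  moreover have "A u \<bullet> v = norm u * norm (A u)"
    using pos unfolding v_def by (simp add: dot_square_norm power2_eq_square)
  ultimately have "norm u * norm (A u) \<le> norm u * (r * norm u)"
    by (simp add: power2_eq_square mult_ac)
  then show ?thesis using pos by simp
qed

lemma symmetric_matrix_inner:
  fixes A :: "real^'v^'v"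
  assumes "transpose A = A"
  shows "(A *v u) \<bullet> v = u \<bullet> (A *v v)"
  by (metis assms dot_lmul_matrix inner_commute vector_transpose_matrix)

text \<open>The minimum of the Rayleigh quotient on the unit sphere is attained at an eigenvector.\<close>

lemma lambda_min_le_quadratic_form:
  fixes A :: "real^'v::finite^'v"
  assumes sym: "transpose A = A"
  shows "lambda_min A * (u \<bullet> u) \<le> (A *v u) \<bullet> u"
proof -
  have "continuous_on (sphere 0 1) (\<lambda>w. (A *v w) \<bullet> w)"
    by (intro continuous_intros linear_continuous_on matrix_vector_mul_bounded_linear)
  moreover have "sphere (0 :: real^'v) 1 \<noteq> {}" by simp
  ultimately obtain v :: "real^'v" where v: "v \<in> sphere 0 1"
    and vmin: "\<And>w. w \<in> sphere 0 1 \<Longrightarrow> (A *v v) \<bullet> v \<le> (A *v w) \<bullet> w"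
    using continuous_attains_inf[OF compact_sphere, of 0 1 "\<lambda>w. (A *v w) \<bullet> w"] by blast
  define m where "m = (A *v v) \<bullet> v"
  have nv: "norm v = 1" using v by simp
  have ray: "m * (w \<bullet> w) \<le> (A *v w) \<bullet> w" for w
  proof (cases "w = 0")
    case False
    have "m \<le> (A *v (w /\<^sub>R norm w)) \<bullet> (w /\<^sub>R norm w)"
      unfolding m_def by (rule vmin) (use False in simp)
    also have "\<dots> = ((A *v w) \<bullet> w) / (norm w)\<^sup>2"
      by (simp add: matrix_vector_mult_scaleR power2_eq_square field_simps)
    finally show ?thesis using False by (simp add: dot_square_norm field_simps)
  qed simp
  \<comment> \<open>First-order optimality. At \<open>v + t *\<^sub>R e\<close>, with
    \<open>e\<close> the residual, the form shifted by \<open>m\<close> equals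
    \<open>2 * t * (e \<bullet> e) + t\<^sup>2 * Q\<close>; the constant term vanishes since
    \<open>v\<close> is a unit vector. A small negative \<open>t\<close> would make this
    negative.\<close>
  have eig: "A *v v = m *\<^sub>R v"
  proof (rule ccontr)
    assume "A *v v \<noteq> m *\<^sub>R v"
    define e where "e = A *v v - m *\<^sub>R v"
    define Q where "Q = (A *v e) \<bullet> e - m * (e \<bullet> e)"
    have e0: "0 < e \<bullet> e" using \<open>A *v v \<noteq> m *\<^sub>R v\<close> unfolding e_def by simp
    have Q0: "0 \<le> Q" using ray[of e] unfolding Q_def by simp
    have vv: "v \<bullet> v = 1" using nv by (simp add: dot_square_norm)
    have quad: "0 \<le> 2 * t * (e \<bullet> e) + t\<^sup>2 * Q" for t
    proof -
      have "(A *v e) \<bullet> v = e \<bullet> (A *v v)" by (rule symmetric_matrix_inner[OF sym])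
      moreover have "e \<bullet> (A *v v) - m * (e \<bullet> v) = e \<bullet> e"
        unfolding e_def by (simp add: inner_diff_right inner_diff_left)
      ultimately have "(A *v (v + t *\<^sub>R e)) \<bullet> (v + t *\<^sub>R e)
          - m * ((v + t *\<^sub>R e) \<bullet> (v + t *\<^sub>R e)) =
          2 * t * (e \<bullet> (A *v v) - m * (e \<bullet> v)) + t\<^sup>2 * Q"
        using vv unfolding Q_def m_def
        by (simp add: matrix_vector_mult_scaleR matrix_vector_right_distrib
            inner_commute power2_eq_square algebra_simps)
      with ray[of "v + t *\<^sub>R e"] \<open>e \<bullet> (A *v v) - m * (e \<bullet> v) = e \<bullet> e\<close> show ?thesis by simp
    qed
    \<comment> \<open>Small enough that \<open>t * Q \<ge> - (e \<bullet> e)\<close>, so the linear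
      term wins; the \<open>+ 1\<close> keeps the denominator positive when
      \<open>Q = 0\<close>.\<close>
    define t where "t = - (e \<bullet> e) / (Q + 1)"
    have "t < 0" using e0 Q0 unfolding t_def by (simp add: field_simps)
    have "2 * (e \<bullet> e) + t * Q \<le> 0"
    proof -
      have "0 \<le> t * (2 * (e \<bullet> e) + t * Q)" using quad[of t] by (simp add: power2_eq_square algebra_simps)
      then show ?thesis using \<open>t < 0\<close> by (simp add: zero_le_mult_iff)
    qed
    moreover have "t * Q \<ge> - (e \<bullet> e)"
      using e0 Q0 unfolding t_def by (simp add: field_simps)
    ultimately show False using e0 by simp
  qed
  have "lambda_min A = m" unfolding lambda_min_def
  proof (rule Least_equality)
    show "is_eigenvalue A m" unfolding is_eigenvalue_def using eig nv by (metis norm_zero zero_neq_one)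
    fix l assume "is_eigenvalue A l"
    then obtain w where w: "w \<noteq> 0" "A *v w = l *\<^sub>R w" unfolding is_eigenvalue_def by blast
    have "m * (w \<bullet> w) \<le> l * (w \<bullet> w)" using ray[of w] w by simp
    then show "m \<le> l" using w by simp
  qed
  then show ?thesis using ray by simp
qed

section \<open>Quadratic form of the block action on stacked vectors\<close>

lemma linear_block_mult: "linear (\<lambda>x. A *b x)"
  unfolding block_mult_def
  by (rule linearI) (simp_all add: vec_eq_iff scaleR_right_distrib sum.distrib sum_distrib_left algebra_simps)

lemma block_mult_inner:
  "(A *b x) \<bullet> y = (\<Sum>i\<in>UNIV. \<Sum>j\<in>UNIV. A $ i $ j * (x $ j \<bullet> y $ i))"
  unfolding block_mult_def inner_vec_def[of "\<chi> i. _ i"] by (simp add: inner_sum_left)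

lemma symmetric_block_mult_inner:
  assumes "transpose A = A"
  shows "(A *b x) \<bullet> y = x \<bullet> (A *b y)"
proof -
  have A: "A $ i $ j = A $ j $ i" for i j
    using assms by (metis transpose_def vec_lambda_beta)
  have "(A *b x) \<bullet> y = (\<Sum>j\<in>UNIV. \<Sum>i\<in>UNIV. A $ i $ j * (x $ j \<bullet> y $ i))"
    unfolding block_mult_inner by (rule sum.swap)
  also have "\<dots> = (A *b y) \<bullet> x"
    unfolding block_mult_inner by (simp add: A[of _ "_ :: 'a"] inner_commute)
  finally show ?thesis by (simp add: inner_commute)
qed

text \<open>The block action treats each of the coordinates \<open>c\<close> of the agent variables
  separately, so both sides are sums over \<open>c\<close> of the forms for the slices
  \<open>col c\<close>.\<close>

lemma lambda_min_le_block_quadratic_form: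
  fixes x :: "real^'n^'v::finite"
  assumes "transpose A = A"
  shows "lambda_min A * (x \<bullet> x) \<le> (A *b x) \<bullet> x"
proof -
  define col where "col c = (\<chi> i. x $ i $ c)" for c
  have "x \<bullet> x = (\<Sum>c\<in>UNIV. col c \<bullet> col c)"
    unfolding col_def inner_vec_def by (simp, rule sum.swap)
  moreover have "(A *b x) \<bullet> x = (\<Sum>c\<in>UNIV. (A *v col c) \<bullet> col c)"
    unfolding col_def inner_vec_def block_mult_def matrix_vector_mult_def by (simp, rule sum.swap)
  ultimately show ?thesis
    by (simp add: sum_distrib_left sum_mono lambda_min_le_quadratic_form[OF assms])
qed

text \<open>Each inner product is at most the mean of the two squared norms; column sums evaluate
  one half of the resulting double sum, row sums the other.\<close>

lemma doubly_stochastic_quadratic_form_le: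
  fixes x :: "real^'n^'v::finite"
  assumes "doubly_stochastic A"
  shows "(A *b x) \<bullet> x \<le> x \<bullet> x"
proof -
  have row: "(\<Sum>j\<in>UNIV. A $ i $ j) = 1" and col: "(\<Sum>i\<in>UNIV. A $ i $ j) = 1"
    and nonneg: "0 \<le> A $ i $ j" for i j
    using assms unfolding doubly_stochastic_def by auto
  have amgm: "u \<bullet> v \<le> (u \<bullet> u + v \<bullet> v) / 2" for u v :: "real^'n"
    using inner_ge_zero[of "u - v"] by (simp add: algebra_simps inner_commute)
  have "(A *b x) \<bullet> x \<le> (\<Sum>i\<in>UNIV. \<Sum>j\<in>UNIV. A $ i $ j * ((x $ j \<bullet> x $ j + x $ i \<bullet> x $ i) / 2))"
    unfolding block_mult_inner by (intro sum_mono mult_left_mono amgm nonneg)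
  also have "\<dots> = (\<Sum>i\<in>UNIV. \<Sum>j\<in>UNIV. A $ i $ j * (x $ j \<bullet> x $ j)) / 2
      + (\<Sum>i\<in>UNIV. \<Sum>j\<in>UNIV. A $ i $ j * (x $ i \<bullet> x $ i)) / 2"
    by (simp add: sum.distrib[symmetric] sum_divide_distrib add_divide_distrib distrib_left)
  also have "(\<Sum>i\<in>UNIV. \<Sum>j\<in>UNIV. A $ i $ j * (x $ j \<bullet> x $ j)) = x \<bullet> x"
    by (subst sum.swap) (simp add: sum_distrib_right[symmetric] col inner_vec_def)
  also have "(\<Sum>i\<in>UNIV. \<Sum>j\<in>UNIV. A $ i $ j * (x $ i \<bullet> x $ i)) = x \<bullet> x"
    by (simp add: sum_distrib_right[symmetric] row inner_vec_def)
  finally show ?thesis by simp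
qed

lemma block_mult_near_scaling:
  fixes x :: "real^'n^'v::finite"
  assumes sym: "transpose A = A" and ds: "doubly_stochastic A"
  shows "norm (A *b x - ((1 + lambda_min A) / 2) *\<^sub>R x) \<le> (1 - lambda_min A) / 2 * norm x"
proof (rule selfadjoint_norm_le)
  let ?l = "lambda_min A"
  show "linear (\<lambda>x :: real^'n^'v. A *b x - ((1 + ?l) / 2) *\<^sub>R x)"
    by (intro linear_compose_sub linear_block_mult linear_scale_self)
  show "(A *b u - ((1 + ?l) / 2) *\<^sub>R u) \<bullet> v = u \<bullet> (A *b v - ((1 + ?l) / 2) *\<^sub>R v)"
    for u v :: "real^'n^'v"
    by (simp add: inner_diff_left inner_diff_right symmetric_block_mult_inner[OF sym])
  show "\<bar>(A *b u - ((1 + ?l) / 2) *\<^sub>R u) \<bullet> u\<bar> \<le> (1 - ?l) / 2 * (u \<bullet> u)" for u :: "real^'n^'v"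
    using lambda_min_le_block_quadratic_form[OF sym, of u]
      doubly_stochastic_quadratic_form_le[OF ds, of u]
    by (simp add: inner_diff_left abs_le_iff field_simps)
qed

subsection \<open>Contraction and convergence\<close>

text \<open>Stated for a general \<open>T\<close> so as to cover both iterations: \<open>W\<close>
  with \<open>l = lambda_min W\<close>, and the identity with \<open>l = 1\<close>.\<close>

lemma gradient_step_lipschitz:
  fixes f :: "'v::finite \<Rightarrow> real^'n \<Rightarrow> real" and T :: "real^'n^'v \<Rightarrow> real^'n^'v"
  assumes f: "\<And>i. strongly_convex \<mu> (f i)" "\<And>i. smooth_fun L (f i)"
    and "0 \<le> \<alpha>" and lin: "linear T"
    and T: "\<And>x. norm (T x - ((1 + l) / 2) *\<^sub>R x) \<le> (1 - l) / 2 * norm x"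
  shows "norm ((T x - \<alpha> *\<^sub>R stack_grad f x) - (T y - \<alpha> *\<^sub>R stack_grad f y))
    \<le> max \<bar>1 - \<alpha> * \<mu>\<bar> \<bar>l - \<alpha> * L\<bar> * norm (x - y)"
proof -
  define d where "d = x - y"
  define G where "G = stack_grad f x - stack_grad f y - ((\<mu> + L) / 2) *\<^sub>R d"
  have G: "norm G \<le> (L - \<mu>) / 2 * norm d"
    unfolding G_def d_def using f by (rule stack_grad_near_scaling)
  define c where "c = (1 + l) / 2 - \<alpha> * ((\<mu> + L) / 2)"
  have "(T x - \<alpha> *\<^sub>R stack_grad f x) - (T y - \<alpha> *\<^sub>R stack_grad f y)
      = c *\<^sub>R d + (T d - ((1 + l) / 2) *\<^sub>R d) - \<alpha> *\<^sub>R G"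
    unfolding G_def c_def using linear_diff[OF lin, of x y]
    by (simp add: d_def[symmetric] scaleR_diff_left scaleR_diff_right)
  also have "norm \<dots> \<le> norm (c *\<^sub>R d) + norm (T d - ((1 + l) / 2) *\<^sub>R d) + norm (\<alpha> *\<^sub>R G)"
    by (meson norm_triangle_ineq norm_triangle_ineq4 add_mono order_refl order_trans)
  also have "\<dots> \<le> \<bar>c\<bar> * norm d + (1 - l) / 2 * norm d + \<alpha> * ((L - \<mu>) / 2 * norm d)"
    using T[of d] mult_left_mono[OF G \<open>0 \<le> \<alpha>\<close>] \<open>0 \<le> \<alpha>\<close> by simp
  also have "\<dots> = (\<bar>c\<bar> + (1 - l) / 2 + \<alpha> * ((L - \<mu>) / 2)) * norm d"
    by (simp add: algebra_simps)
  \<comment> \<open>With \<open>r = (1 - l) / 2 + \<alpha> * ((L - \<mu>) / 2)\<close>, the numbers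
    \<open>c + r\<close> and \<open>c - r\<close> are \<open>1 - \<alpha> * \<mu>\<close> and
    \<open>l - \<alpha> * L\<close>, and \<open>\<bar>c\<bar> + r\<close> is at most the larger of
    their absolute values.\<close>
  also have "\<dots> \<le> max \<bar>1 - \<alpha> * \<mu>\<bar> \<bar>l - \<alpha> * L\<bar> * norm d"
    by (rule mult_right_mono) (auto simp: c_def abs_if max_def field_simps)
  finally show ?thesis unfolding d_def .
qed

text \<open>\<open>r\<close> may be 1 or more, because the theorem claims its error bound for every
  value of \<open>\<zeta>\<close>.\<close>

lemma iterates_geometric:
  fixes S :: "'a::real_normed_vector \<Rightarrow> 'a"
  assumes "\<And>u v. norm (S u - S v) \<le> r * norm (u - v)" and "0 \<le> r"
    and "S p = p" and "\<And>k. u (Suc k) = S (u k)"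
  shows "norm (u k - p) \<le> norm (u 0 - p) * r ^ k"
proof (induction k)
  case (Suc k)
  have "norm (u (Suc k) - p) \<le> r * norm (u k - p)"
    using assms(1)[of "u k" p] assms(3,4) by simp
  also have "\<dots> \<le> r * (norm (u 0 - p) * r ^ k)"
    using Suc \<open>0 \<le> r\<close> by (rule mult_left_mono)
  finally show ?case by (simp add: mult_ac)
qed simp

lemma mat_1_diff_diag_matrix: "mat 1 - diag_matrix d = diag_matrix (\<lambda>i. 1 - d i)"
  by (simp add: vec_eq_iff mat_def diag_matrix_def)

lemma block_mult_diag_matrix: "(diag_matrix d *b x) $ i = d i *\<^sub>R x $ i"
  unfolding block_mult_def diag_matrix_def
  by (simp add: if_distrib[of "\<lambda>c. c *\<^sub>R _"] cong: if_cong)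

lemma norm_block_mult_diag_matrix_le:
  assumes "\<And>i. d i \<in> {0..1}"
  shows "norm (diag_matrix d *b x) \<le> norm x"
  using norm_stack_le[of "diag_matrix d *b x" 1 x] assms
  by (simp add: block_mult_diag_matrix mult_left_le_one_le)

lemma geometric_bound_imp_converges_linearly:
  assumes "geometric_bound X l r" and "0 \<le> r" and "r < 1"
  shows "converges_linearly X l r"
proof -
  obtain C where C: "norm (X k - l) \<le> C * r ^ k" for k
    using assms(1) unfolding geometric_bound_def by blast
  have "(\<lambda>k. C * r ^ k) \<longlonglongrightarrow> 0"
    using assms(2,3) by (intro tendsto_mult_right_zero LIMSEQ_realpow_zero)
  then have "(\<lambda>k. X k - l) \<longlonglongrightarrow> 0"
    by (rule Lim_null_comparison[rotated]) (simp add: C)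
  then show ?thesis
    using assms unfolding converges_linearly_def by (simp add: LIM_zero_iff)
qed

text \<open>A large step size can give \<open>\<zeta> \<ge> 1\<close>, so the error bound is claimed
  always and convergence when \<open>\<zeta> < 1\<close>. Symmetry of \<open>W\<close> makes its
  spectrum real, which gives \<open>lambda_min W\<close> its meaning.\<close>

theorem theorem1:
  fixes E :: "('v::finite \<times> 'v) set"
    and f :: "'v \<Rightarrow> real^'n \<Rightarrow> real"
    and W :: "real^'v^'v"
    and \<mu> L \<alpha> \<zeta> :: real
    and lam :: "'v \<Rightarrow> real"
    and xstar xbar :: "real^'n^'v"
    and x y z :: "nat \<Rightarrow> real^'n^'v"
  assumes graph: "sym E"
    and mu_L: "0 < \<mu>" "0 < L"
    and convex: "\<And>i. strongly_convex \<mu> (f i)"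
    and smooth: "\<And>i. smooth_fun L (f i)"
    and W_ds: "doubly_stochastic W"
    and W_weights: "communication_weights E W"
    and W_sym: "transpose W = W"
    and step: "0 < \<alpha>"
    and lam: "\<And>i. lam i \<in> {0..1}"
    and xstar: "\<And>i. is_arg_min (f i) (\<lambda>_. True) (xstar $ i)"
    and xbar: "xbar = W *b xbar - \<alpha> *\<^sub>R stack_grad f xbar"
    and y_0: "y 0 = x 0"
    and y_Suc: "\<And>k. y (Suc k) = y k - \<alpha> *\<^sub>R stack_grad f (y k)"
    and z_0: "z 0 = x 0"
    and z_Suc: "\<And>k. z (Suc k) = W *b z k - \<alpha> *\<^sub>R stack_grad f (z k)"
    and x_Suc: "\<And>k. x (Suc k) =
          diag_matrix lam *b y (Suc k) + (mat 1 - diag_matrix lam) *b z (Suc k)"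
    and zeta: "\<zeta> = Max {\<bar>1 - \<alpha> * \<mu>\<bar>, \<bar>1 - \<alpha> * L\<bar>, \<bar>lambda_min W - \<alpha> * L\<bar>}"
  shows "geometric_bound x (diag_matrix lam *b xstar + (mat 1 - diag_matrix lam) *b xbar) \<zeta> \<and>
    (\<zeta> < 1 \<longrightarrow>
      converges_linearly x (diag_matrix lam *b xstar + (mat 1 - diag_matrix lam) *b xbar) \<zeta>)"
proof -
  define \<Lambda> where "\<Lambda> = diag_matrix lam"
  define \<Gamma> where "\<Gamma> = mat 1 - diag_matrix lam"
  define p where "p = \<Lambda> *b xstar + \<Gamma> *b xbar"
  have \<zeta>: "0 \<le> \<zeta>" "max \<bar>1 - \<alpha> * \<mu>\<bar> \<bar>1 - \<alpha> * L\<bar> \<le> \<zeta>" "max \<bar>1 - \<alpha> * \<mu>\<bar> \<bar>lambda_min W - \<alpha> * L\<bar> \<le> \<zeta>"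
    unfolding zeta by auto
  have lip_y: "norm ((u - \<alpha> *\<^sub>R stack_grad f u) - (v - \<alpha> *\<^sub>R stack_grad f v)) \<le> \<zeta> * norm (u - v)" for u v
  proof -
    have "norm ((u - \<alpha> *\<^sub>R stack_grad f u) - (v - \<alpha> *\<^sub>R stack_grad f v))
        \<le> max \<bar>1 - \<alpha> * \<mu>\<bar> \<bar>1 - \<alpha> * L\<bar> * norm (u - v)"
      by (rule gradient_step_lipschitz[where T = "\<lambda>x. x", OF convex smooth])
        (use step in \<open>auto intro: linear_ident\<close>)
    also have "\<dots> \<le> \<zeta> * norm (u - v)" using \<zeta>(2) by (rule mult_right_mono) simp
    finally show ?thesis .
  qed
  have lip_z: "norm ((W *b u - \<alpha> *\<^sub>R stack_grad f u) - (W *b v - \<alpha> *\<^sub>R stack_grad f v)) \<le> \<zeta> * norm (u - v)" for u v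
  proof -
    have "norm ((W *b u - \<alpha> *\<^sub>R stack_grad f u) - (W *b v - \<alpha> *\<^sub>R stack_grad f v))
        \<le> max \<bar>1 - \<alpha> * \<mu>\<bar> \<bar>lambda_min W - \<alpha> * L\<bar> * norm (u - v)"
      using step by (intro gradient_step_lipschitz convex smooth linear_block_mult
          block_mult_near_scaling W_sym W_ds) simp
    also have "\<dots> \<le> \<zeta> * norm (u - v)" using \<zeta>(3) by (rule mult_right_mono) simp
    finally show ?thesis .
  qed
  \<comment> \<open>Stationarity makes \<open>xstar\<close> a fixed point of the plain gradient
    step.\<close>
  have "grad (f i) (xstar $ i) = 0" for i
    using grad_eq_0_if_is_arg_min xstar smooth unfolding smooth_fun_def by blast
  then have "stack_grad f xstar = 0" by (simp add: stack_grad_def vec_eq_iff)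
  then have y: "norm (y k - xstar) \<le> norm (y 0 - xstar) * \<zeta> ^ k" for k
    by (intro iterates_geometric[where S = "\<lambda>u. u - \<alpha> *\<^sub>R stack_grad f u"] lip_y \<zeta>(1) y_Suc) simp
  have z: "norm (z k - xbar) \<le> norm (z 0 - xbar) * \<zeta> ^ k" for k
    by (intro iterates_geometric[where S = "\<lambda>u. W *b u - \<alpha> *\<^sub>R stack_grad f u"]
        lip_z \<zeta>(1) xbar[symmetric] z_Suc)
  \<comment> \<open>The recursion gives this only for positive indices; at \<open>k = 0\<close> it
    holds because both iterations start at \<open>x 0\<close> and the weights sum to the
    identity.\<close>
  have x: "x k = \<Lambda> *b y k + \<Gamma> *b z k" for k
  proof (cases k)
    case 0
    then show ?thesis unfolding \<Lambda>_def \<Gamma>_def mat_1_diff_diag_matrix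
      by (simp add: y_0 z_0 vec_eq_iff block_mult_diag_matrix algebra_simps)
  qed (simp add: x_Suc \<Lambda>_def \<Gamma>_def)
  have "norm (x k - p) \<le> (norm (y 0 - xstar) + norm (z 0 - xbar)) * \<zeta> ^ k" for k
  proof -
    have "x k - p = \<Lambda> *b (y k - xstar) + \<Gamma> *b (z k - xbar)"
      unfolding x p_def by (simp add: linear_diff[OF linear_block_mult])
    then have "norm (x k - p) \<le> norm (\<Lambda> *b (y k - xstar)) + norm (\<Gamma> *b (z k - xbar))"
      by (simp add: norm_triangle_ineq)
    \<comment> \<open>The diagonal entries of both \<open>\<Lambda>\<close> and
      \<open>\<Gamma>\<close> lie in \<open>[0, 1]\<close>; adding the two errors affects only the
      constant, not the rate.\<close>
    also have "\<dots> \<le> norm (y k - xstar) + norm (z k - xbar)"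
      unfolding \<Lambda>_def \<Gamma>_def mat_1_diff_diag_matrix
      by (intro add_mono norm_block_mult_diag_matrix_le) (use lam in auto)
    also have "\<dots> \<le> (norm (y 0 - xstar) + norm (z 0 - xbar)) * \<zeta> ^ k"
      using y[of k] z[of k] by (simp add: distrib_right)
    finally show ?thesis .
  qed
  then have "geometric_bound x p \<zeta>"
    unfolding geometric_bound_def by (meson add_nonneg_nonneg norm_ge_zero)
  then show ?thesis
    using geometric_bound_imp_converges_linearly \<zeta>(1) unfolding p_def \<Lambda>_def \<Gamma>_def by blast
qed

end
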